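(* Let $u^0\in H^2_0(\Omega)$, $v^0\in L^2(\Omega)$, $f\in C([0,T];L^2(\Omega))$, and let $U^0,U^1,\dots,U^N\in V_h$ be defined by the implicit scheme $U^0=\mathcal R_hu^0$, $$2k^{-1}(\bar\partial_tU^{1/2},v_h)+a_h(U^{1/2},v_h)=(f^{1/2}+2k^{-1}v^0,v_h)\quad\text{for all }v_h\in V_h,$$ and, for $n=1,\dots,N-1$, $$(\bar\partial_t^2U^n,v_h)+a_h(U^{n,1/4},v_h)=(f^{n,1/4},v_h)\quad\text{for all }v_h\in V_h .$$ Then the scheme is stable: there is a constant $C>0$, depending on $\alpha,\beta,T$ but independent of $h$ and $k$, such that for $1\le m\le N-1$ $$\|\bar\partial_tU^{m+1/2}\|+\|U^{m+1/2}\|_h\le C\big(\|\bar\partial_tU^{1/2}\|+\|U^{1/2}\|_h+\|f\|_{L^\infty(0,T;L^2(\Omega))}\big).$$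
   Context: Time grid: $N$ is a positive integer, $k=T/N$, $t_n=nk$. For a function of time $\phi$ (or a sequence $\phi^n$): $\phi^n=\phi(t_n)$, $\phi^{n+1/2}=\frac12(\phi^{n+1}+\phi^n)$, $\phi^{n,1/4}=\frac14(\phi^{n+1}+2\phi^n+\phi^{n-1})$, $\bar\partial_t\phi^{n+1/2}=(\phi^{n+1}-\phi^n)/k$, $\bar\partial_t^2\phi^n=(\phi^{n+1}-2\phi^n+\phi^{n-1})/k^2$. $\Omega\subset\mathbb R^2$ is a bounded polygonal Lipschitz domain, $T>0$; $(\cdot,\cdot)$ and $\|\cdot\|$ are the $L^2(\Omega)$ inner product and norm; $a(w,v)=\int_\Omega D^2w:D^2v\,dx$ on $H^2_0(\Omega)$. Mesh: $\mathcal T$ is a shape-regular triangulation of $\overline\Omega$ (not necessarily quasi-uniform) with mesh-size $h=\max_{K\in\mathcal T}\mathrm{diam}(K)$, edges $\mathcal E$, vertices $\mathcal V$; $\mathcal V(e)$ is the set of endpoints of edge $e$ and $h_e$ its length; $[\![\cdot]\!]$ is the jump across an interior edge and the trace on a boundary edge; $\{\!\{\cdot\}\!\}$ is the average across an interior edge; $H^2(\mathcal T)$ is the space of piecewise $H^2$ functions; $P_r(\mathcal T)$ is the space of piecewise polynomials of degree at most $r$. Discrete space and form: $\mathrm M(\mathcal T)\subset P_2(\mathcal T)$ is the Morley space: piecewise quadratics continuous at interior vertices, with normal derivatives continuous at midpoints of interior edges, vanishing at boundary vertices and with normal derivatives vanishing at midpoints of boundary edges. $V_h\subset H^2(\mathcal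 T)$ is a finite-dimensional subspace with the norm $$\|v_h\|_h^2=\sum_{K\in\mathcal T}|v_h|_{H^2(K)}^2+\sum_{e\in\mathcal E}\sum_{z\in\mathcal V(e)}h_e^{-2}\big|[\![v_h]\!](z)\big|^2+\sum_{e\in\mathcal E}\Big|\frac1{h_e}\int_e\Big[\!\Big[\frac{\partial v_h}{\partial n}\Big]\!\Big]ds\Big|^2 ,$$ and $a_h$ is a symmetric bilinear form on $V_h+\mathrm M(\mathcal T)$ such that, for all $w_h,v_h\in V_h$, $\alpha\|w_h\|_h^2\le a_h(w_h,w_h)$ and $a_h(w_h,v_h)\le\beta\|w_h\|_h\|v_h\|_h$ with constants $\alpha,\beta>0$ independent of $h$. (The Morley, quadratic discontinuous Galerkin and quadratic $C^0$ interior penalty methods are instances.) Smoother: $I_{\mathrm M}:H^2(\mathcal T)\to\mathrm M(\mathcal T)$ is the extended Morley interpolation: at each interior vertex $z$, $(I_{\mathrm M}v)(z)$ is the average of the values $(v|_K)(z)$ over the triangles $K$ containing $z$, and on each interior edge $\int_e\partial_n(I_{\mathrm M}v)\,ds=\int_e\{\!\{\partial_nv\}\!\}\,ds$ (boundary degrees of freedom vanish). $J:\mathrm M(\mathcal T)\to H^2_0(\Omega)$ is a fixed linear companion operator, with values in the sum of the Hsieh–Clough–Tocher space and $P_8(\mathcal T)$, such that for $w\in\mathrm M(\mathcal T)$: $Jw=w$ at all vertices, $\nabla(Jw)(z)$ is the average of $(\nabla w|_K)(z)$ over the triangles $K$ containing $z$ at every interior vertex $z$, and $\int_e\partial_n(Jw)\,ds=\int_e\partial_nw\,ds$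 for every edge $e$. Put $Q:=J I_{\mathrm M}:V_h\to H^2_0(\Omega)$. Modified Ritz projection $\mathcal R_h:H^2_0(\Omega)\to V_h$: $a_h(\mathcal R_hw,v_h)=a(w,Qv_h)$ for all $v_h\in V_h$. *)

theory Defs
  imports "HOL-Analysis.Analysis" "HOL-Probability.Essential_Supremum"
begin

text \<open>
  Elements of Lebesgue and Sobolev spaces over a set \<open>U\<close> are represented by functions on the whole
  plane; only the values on \<open>U\<close>, up to a Lebesgue null set, matter. Objects that are unique only up to
  a null set (weak derivatives, traces, interpolants) are picked by \<open>SOME\<close>.
\<close>

type_synonym plane = "real^2"
type_synonym pfun = "plane \<Rightarrow> real"

subsection \<open>Domain and mesh\<close>

definition polygonal_lipschitz_domain :: "plane set \<Rightarrow> bool" where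
  "polygonal_lipschitz_domain \<Omega> \<longleftrightarrow>
     open \<Omega> \<and> connected \<Omega> \<and> \<Omega> \<noteq> {} \<and> bounded \<Omega> \<and>
     (\<exists>S. finite S \<and> frontier \<Omega> = (\<Union>(a, b)\<in>S. closed_segment a b)) \<and>
     (\<forall>z\<in>frontier \<Omega>. \<exists>\<nu> \<tau> L r \<phi>. norm \<nu> = 1 \<and> norm \<tau> = 1 \<and> \<nu> \<bullet> \<tau> = 0 \<and> r > 0 \<and>
        L-lipschitz_on UNIV (\<phi> :: real \<Rightarrow> real) \<and>
        (\<forall>x\<in>ball z r. x \<in> \<Omega> \<longleftrightarrow> (x - z) \<bullet> \<nu> > \<phi> ((x - z) \<bullet> \<tau>)))"

definition triangulation_of :: "plane set \<Rightarrow> plane set set \<Rightarrow> bool" where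
  "triangulation_of \<Omega> \<T> \<longleftrightarrow> triangulation \<T> \<and> (\<forall>K\<in>\<T>. 2 simplex K) \<and> \<Union>\<T> = closure \<Omega>"

definition shape_regular :: "real \<Rightarrow> plane set set \<Rightarrow> bool" where
  "shape_regular \<sigma> \<T> \<longleftrightarrow> (\<forall>K\<in>\<T>. \<exists>x r. r > 0 \<and> cball x r \<subseteq> K \<and> diameter K \<le> \<sigma> * r)"

definition vertices :: "plane set set \<Rightarrow> plane set" where
  "vertices \<T> = {z. \<exists>K\<in>\<T>. z extreme_point_of K}"

definition edges :: "plane set set \<Rightarrow> plane set set" where
  "edges \<T> = {e. \<exists>K\<in>\<T>. e edge_of K}"

definition edge_ends :: "plane set \<Rightarrow> plane \<times> plane" where
  "edge_ends e = (SOME (a, b). e = closed_segment a b)"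

definition edge_mid :: "plane set \<Rightarrow> plane" where
  "edge_mid e = (case edge_ends e of (a, b) \<Rightarrow> midpoint a b)"

text \<open>The orientation of the normal and the labelling of the two sides of an edge are arbitrary but
  fixed; nothing below depends on the choice.\<close>

definition edge_normal :: "plane set \<Rightarrow> plane" where
  "edge_normal e = (SOME n. norm n = 1 \<and> (\<forall>x\<in>e. \<forall>y\<in>e. n \<bullet> (x - y) = 0))"

definition side_plus :: "plane set set \<Rightarrow> plane set \<Rightarrow> plane set" where
  "side_plus \<T> e = (SOME K. K \<in> \<T> \<and> e edge_of K)"

definition side_minus :: "plane set set \<Rightarrow> plane set \<Rightarrow> plane set" where
  "side_minus \<T> e = (SOME K. K \<in> \<T> \<and> e edge_of K \<and> K \<noteq> side_plus \<T> e)"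

text \<open>Jump and average of a quantity \<open>g\<close> given by its one-sided values \<open>g K\<close>.\<close>

definition jump :: "plane set \<Rightarrow> plane set set \<Rightarrow> plane set \<Rightarrow> (plane set \<Rightarrow> real) \<Rightarrow> real" where
  "jump \<Omega> \<T> e g =
     (if e \<subseteq> frontier \<Omega> then g (side_plus \<T> e) else g (side_plus \<T> e) - g (side_minus \<T> e))"

definition average :: "plane set set \<Rightarrow> plane set \<Rightarrow> (plane set \<Rightarrow> real) \<Rightarrow> real" where
  "average \<T> e g = (g (side_plus \<T> e) + g (side_minus \<T> e)) / 2"

text \<open>Integral and square integrability with respect to arc length on a segment.\<close>

definition edge_integral :: "plane set \<Rightarrow> pfun \<Rightarrow> real" where
  "edge_integral e g = (case edge_ends e of (a, b) \<Rightarrow>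
     dist a b * integral\<^sup>L (lebesgue_on {0..1}) (\<lambda>t. g (linepath a b t)))"

definition edge_L2 :: "plane set \<Rightarrow> pfun set" where
  "edge_L2 e = {g. case edge_ends e of (a, b) \<Rightarrow>
     (\<lambda>t. g (linepath a b t)) \<in> borel_measurable (lebesgue_on {0..1}) \<and>
     integrable (lebesgue_on {0..1}) (\<lambda>t. (g (linepath a b t))\<^sup>2)}"

subsection \<open>Lebesgue and Sobolev spaces\<close>

definition L2 :: "plane set \<Rightarrow> pfun set" where
  "L2 U = {v. v \<in> borel_measurable (lebesgue_on U) \<and> integrable (lebesgue_on U) (\<lambda>x. (v x)\<^sup>2)}"

definition l2_inner :: "plane set \<Rightarrow> pfun \<Rightarrow> pfun \<Rightarrow> real" where
  "l2_inner U v w = integral\<^sup>L (lebesgue_on U) (\<lambda>x. v x * w x)"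

definition l2_norm :: "plane set \<Rightarrow> pfun \<Rightarrow> real" where
  "l2_norm U v = sqrt (l2_inner U v v)"

definition partial :: "2 \<Rightarrow> pfun \<Rightarrow> pfun" where
  "partial i f = (\<lambda>x. frechet_derivative f (at x) (axis i 1))"

fun Ck :: "nat \<Rightarrow> pfun \<Rightarrow> bool" where
  "Ck 0 f = continuous_on UNIV f"
| "Ck (Suc n) f = ((\<forall>x. f differentiable (at x)) \<and> (\<forall>i. Ck n (partial i f)))"

definition smooth :: "pfun \<Rightarrow> bool" where
  "smooth f \<longleftrightarrow> (\<forall>n. Ck n f)"

definition test_function :: "plane set \<Rightarrow> pfun \<Rightarrow> bool" where
  "test_function U \<phi> \<longleftrightarrow> smooth \<phi> \<and> compact (closure {x. \<phi> x \<noteq> 0}) \<and> closure {x. \<phi> x \<noteq> 0} \<subseteq> U"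

definition is_weak_partial :: "plane set \<Rightarrow> 2 \<Rightarrow> pfun \<Rightarrow> pfun \<Rightarrow> bool" where
  "is_weak_partial U i v w \<longleftrightarrow>
     (\<forall>\<phi>. test_function U \<phi> \<longrightarrow> l2_inner U v (partial i \<phi>) = - l2_inner U w \<phi>)"

definition weak_partial :: "plane set \<Rightarrow> 2 \<Rightarrow> pfun \<Rightarrow> pfun" where
  "weak_partial U i v = (SOME w. w \<in> L2 U \<and> is_weak_partial U i v w)"

definition H1 :: "plane set \<Rightarrow> pfun set" where
  "H1 U = {v \<in> L2 U. \<forall>i. \<exists>w\<in>L2 U. is_weak_partial U i v w}"

definition H2 :: "plane set \<Rightarrow> pfun set" where
  "H2 U = {v \<in> H1 U. \<forall>i. weak_partial U i v \<in> H1 U}"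

definition h1_norm :: "plane set \<Rightarrow> pfun \<Rightarrow> real" where
  "h1_norm U v = sqrt ((l2_norm U v)\<^sup>2 + (\<Sum>i\<in>UNIV. (l2_norm U (weak_partial U i v))\<^sup>2))"

definition hess_form :: "plane set \<Rightarrow> pfun \<Rightarrow> pfun \<Rightarrow> real" where
  "hess_form U w v = integral\<^sup>L (lebesgue_on U) (\<lambda>x. \<Sum>i\<in>UNIV. \<Sum>j\<in>UNIV.
     weak_partial U i (weak_partial U j w) x * weak_partial U i (weak_partial U j v) x)"

definition h2_seminorm :: "plane set \<Rightarrow> pfun \<Rightarrow> real" where
  "h2_seminorm U v = sqrt (hess_form U v v)"

definition h2_norm :: "plane set \<Rightarrow> pfun \<Rightarrow> real" where
  "h2_norm U v = sqrt ((h1_norm U v)\<^sup>2 + (h2_seminorm U v)\<^sup>2)"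

definition H20 :: "plane set \<Rightarrow> pfun set" where
  "H20 \<Omega> = {v \<in> H2 \<Omega>. \<exists>\<phi> :: nat \<Rightarrow> pfun. (\<forall>n. test_function \<Omega> (\<phi> n)) \<and>
     (\<lambda>n. h2_norm \<Omega> (\<lambda>x. \<phi> n x - v x)) \<longlonglongrightarrow> 0}"

definition H2_pw :: "plane set set \<Rightarrow> pfun set" where
  "H2_pw \<T> = {v. \<forall>K\<in>\<T>. v \<in> H2 (interior K)}"

subsection \<open>Point values and traces\<close>

text \<open>\<open>val K v z\<close> is \<open>(v|\<^sub>K)(z)\<close> for \<open>z \<in> K\<close>, read off the representative of \<open>v|\<^sub>K\<close> that is
  continuous on the closed triangle.\<close>

definition val :: "plane set \<Rightarrow> pfun \<Rightarrow> plane \<Rightarrow> real" where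
  "val K v = (SOME g. continuous_on K g \<and> (AE x in lebesgue_on K. g x = v x))"

text \<open>Trace on the edge \<open>e\<close> of \<open>K\<close> of a function in \<open>H\<^sup>1(K)\<close>: the \<open>L\<^sup>2(e)\<close> limit of the
  restrictions of smooth functions that converge to it in \<open>H\<^sup>1(K)\<close>.\<close>

definition trace :: "plane set \<Rightarrow> plane set \<Rightarrow> pfun \<Rightarrow> pfun" where
  "trace K e g = (SOME \<tau>. \<tau> \<in> edge_L2 e \<and> (\<exists>\<phi> :: nat \<Rightarrow> pfun. (\<forall>n. smooth (\<phi> n)) \<and>
     (\<lambda>n. h1_norm (interior K) (\<lambda>x. \<phi> n x - g x)) \<longlonglongrightarrow> 0 \<and>
     (\<lambda>n. edge_integral e (\<lambda>x. (\<phi> n x - \<tau> x)\<^sup>2)) \<longlonglongrightarrow> 0))"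

definition normal_deriv :: "plane set \<Rightarrow> plane set \<Rightarrow> pfun \<Rightarrow> pfun" where
  "normal_deriv K e v =
     (\<lambda>x. \<Sum>i\<in>UNIV. edge_normal e $ i * trace K e (weak_partial (interior K) i v) x)"

text \<open>One-sided gradient \<open>(\<nabla>v|\<^sub>K)(z)\<close> at points \<open>z \<in> K\<close>, for \<open>v\<close> that is \<open>C\<^sup>1\<close> on the closed triangle:
  the continuous extension to \<open>K\<close> of the classical gradient on the interior.\<close>

definition grad_val :: "plane set \<Rightarrow> pfun \<Rightarrow> plane \<Rightarrow> plane" where
  "grad_val K v = (SOME G. continuous_on K G \<and>
     (\<forall>x\<in>interior K. (val K v has_derivative (\<lambda>y. G x \<bullet> y)) (at x)))"

subsection \<open>Discrete spaces\<close>

definition polynomial_le :: "nat \<Rightarrow> pfun set" where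
  "polynomial_le r = {p. \<exists>c. \<forall>x. p x = (\<Sum>i\<le>r. \<Sum>j\<le>r - i. c i j * (x $ 1) ^ i * (x $ 2) ^ j)}"

definition P_pw :: "nat \<Rightarrow> plane set set \<Rightarrow> pfun set" where
  "P_pw r \<T> = {v. \<forall>K\<in>\<T>. \<exists>p\<in>polynomial_le r. AE x in lebesgue_on K. v x = p x}"

definition Morley :: "plane set \<Rightarrow> plane set set \<Rightarrow> pfun set" where
  "Morley \<Omega> \<T> = {v \<in> P_pw 2 \<T>.
     (\<forall>z\<in>vertices \<T>. z \<in> \<Omega> \<longrightarrow> (\<forall>K\<in>\<T>. \<forall>K'\<in>\<T>. z \<in> K \<and> z \<in> K' \<longrightarrow> val K v z = val K' v z)) \<and>
     (\<forall>z\<in>vertices \<T>. z \<in> frontier \<Omega> \<longrightarrow> (\<forall>K\<in>\<T>. z \<in> K \<longrightarrow> val K v z = 0)) \<and>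
     (\<forall>e\<in>edges \<T>. \<not> e \<subseteq> frontier \<Omega> \<longrightarrow> (\<forall>K\<in>\<T>. \<forall>K'\<in>\<T>. e edge_of K \<and> e edge_of K' \<longrightarrow>
        edge_normal e \<bullet> grad_val K v (edge_mid e) = edge_normal e \<bullet> grad_val K' v (edge_mid e))) \<and>
     (\<forall>e\<in>edges \<T>. e \<subseteq> frontier \<Omega> \<longrightarrow> (\<forall>K\<in>\<T>. e edge_of K \<longrightarrow>
        edge_normal e \<bullet> grad_val K v (edge_mid e) = 0))}"

definition discrete_norm :: "plane set \<Rightarrow> plane set set \<Rightarrow> pfun \<Rightarrow> real" where
  "discrete_norm \<Omega> \<T> v = sqrt (
     (\<Sum>K\<in>\<T>. (h2_seminorm (interior K) v)\<^sup>2) +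
     (\<Sum>e\<in>edges \<T>. \<Sum>z | z extreme_point_of e.
        \<bar>jump \<Omega> \<T> e (\<lambda>K. val K v z)\<bar>\<^sup>2 / (diameter e)\<^sup>2) +
     (\<Sum>e\<in>edges \<T>.
        \<bar>edge_integral e (\<lambda>x. jump \<Omega> \<T> e (\<lambda>K. normal_deriv K e v x)) / diameter e\<bar>\<^sup>2))"

text \<open>Dimension is counted modulo equality almost everywhere on \<open>\<Omega>\<close>.\<close>

definition fin_dim_subspace :: "plane set \<Rightarrow> pfun set \<Rightarrow> bool" where
  "fin_dim_subspace \<Omega> V \<longleftrightarrow> (\<lambda>x. 0) \<in> V \<and>
     (\<forall>v\<in>V. \<forall>w\<in>V. (\<lambda>x. v x + w x) \<in> V) \<and> (\<forall>c. \<forall>v\<in>V. (\<lambda>x. c * v x) \<in> V) \<and>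
     (\<exists>B. finite B \<and> B \<subseteq> V \<and>
        (\<forall>v\<in>V. \<exists>c. AE x in lebesgue_on \<Omega>. v x = (\<Sum>b\<in>B. c b * b x)))"

definition fun_set_plus :: "pfun set \<Rightarrow> pfun set \<Rightarrow> pfun set" where
  "fun_set_plus V W = {\<lambda>x. v x + w x | v w. v \<in> V \<and> w \<in> W}"

definition symmetric_bilinear_on :: "plane set \<Rightarrow> pfun set \<Rightarrow> (pfun \<Rightarrow> pfun \<Rightarrow> real) \<Rightarrow> bool" where
  "symmetric_bilinear_on \<Omega> W b \<longleftrightarrow>
     (\<forall>v\<in>W. \<forall>w\<in>W. b v w = b w v) \<and>
     (\<forall>u\<in>W. \<forall>v\<in>W. \<forall>w\<in>W. b (\<lambda>x. u x + v x) w = b u w + b v w) \<and>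
     (\<forall>c. \<forall>v\<in>W. \<forall>w\<in>W. b (\<lambda>x. c * v x) w = c * b v w) \<and>
     (\<forall>u\<in>W. \<forall>v\<in>W. \<forall>w\<in>W. (AE x in lebesgue_on \<Omega>. u x = v x) \<longrightarrow> b u w = b v w)"

subsection \<open>Smoother and modified Ritz projection\<close>

definition morley_interp :: "plane set \<Rightarrow> plane set set \<Rightarrow> pfun \<Rightarrow> pfun" where
  "morley_interp \<Omega> \<T> v = (SOME w. w \<in> Morley \<Omega> \<T> \<and>
     (\<forall>z\<in>vertices \<T>. z \<in> \<Omega> \<longrightarrow> (\<forall>K\<in>\<T>. z \<in> K \<longrightarrow>
        val K w z = (\<Sum>K' | K' \<in> \<T> \<and> z \<in> K'. val K' v z) / card {K' \<in> \<T>. z \<in> K'})) \<and>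
     (\<forall>e\<in>edges \<T>. \<not> e \<subseteq> frontier \<Omega> \<longrightarrow> (\<forall>K\<in>\<T>. e edge_of K \<longrightarrow>
        edge_integral e (normal_deriv K e w) =
        edge_integral e (\<lambda>x. average \<T> e (\<lambda>K'. normal_deriv K' e v x)))))"

definition barycentre :: "plane set \<Rightarrow> plane" where
  "barycentre K = (1 / 3) *\<^sub>R (\<Sum>z | z extreme_point_of K. z)"

definition hct_refinement :: "plane set set \<Rightarrow> plane set set" where
  "hct_refinement \<T> = {convex hull (insert (barycentre K) e) | K e. K \<in> \<T> \<and> e edge_of K}"

text \<open>Piecewise cubics on the refinement; membership in \<open>H\<^sup>2\<^sub>0(\<Omega>)\<close> encodes \<open>C\<^sup>1\<close>-conformity and the
  clamped boundary conditions.\<close>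

definition HCT :: "plane set \<Rightarrow> plane set set \<Rightarrow> pfun set" where
  "HCT \<Omega> \<T> = H20 \<Omega> \<inter> P_pw 3 (hct_refinement \<T>)"

definition companion_operator :: "plane set \<Rightarrow> plane set set \<Rightarrow> (pfun \<Rightarrow> pfun) \<Rightarrow> bool" where
  "companion_operator \<Omega> \<T> J \<longleftrightarrow>
     (\<forall>w\<in>Morley \<Omega> \<T>. J w \<in> H20 \<Omega> \<inter> fun_set_plus (HCT \<Omega> \<T>) (P_pw 8 \<T>)) \<and>
     (\<forall>w\<in>Morley \<Omega> \<T>. \<forall>w'\<in>Morley \<Omega> \<T>.
        AE x in lebesgue_on \<Omega>. J (\<lambda>y. w y + w' y) x = J w x + J w' x) \<and>
     (\<forall>c. \<forall>w\<in>Morley \<Omega> \<T>. AE x in lebesgue_on \<Omega>. J (\<lambda>y. c * w y) x = c * J w x) \<and>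
     (\<forall>w\<in>Morley \<Omega> \<T>. \<forall>w'\<in>Morley \<Omega> \<T>. (AE x in lebesgue_on \<Omega>. w x = w' x) \<longrightarrow>
        (AE x in lebesgue_on \<Omega>. J w x = J w' x)) \<and>
     (\<forall>w\<in>Morley \<Omega> \<T>.
        (\<forall>z\<in>vertices \<T>. \<forall>K\<in>\<T>. z \<in> K \<longrightarrow> val K (J w) z = val K w z) \<and>
        (\<forall>z\<in>vertices \<T>. z \<in> \<Omega> \<longrightarrow> (\<forall>K\<in>\<T>. z \<in> K \<longrightarrow> grad_val K (J w) z =
           (1 / card {K' \<in> \<T>. z \<in> K'}) *\<^sub>R (\<Sum>K' | K' \<in> \<T> \<and> z \<in> K'. grad_val K' w z))) \<and>
        (\<forall>e\<in>edges \<T>. \<forall>K\<in>\<T>. e edge_of K \<longrightarrow>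
           edge_integral e (normal_deriv K e (J w)) = edge_integral e (normal_deriv K e w)))"

definition smoother :: "plane set \<Rightarrow> plane set set \<Rightarrow> (pfun \<Rightarrow> pfun) \<Rightarrow> pfun \<Rightarrow> pfun" where
  "smoother \<Omega> \<T> J v = J (morley_interp \<Omega> \<T> v)"

text \<open>\<open>r = \<R>\<^sub>h w\<close>, as elements of the space \<open>V\<close> modulo null sets.\<close>

definition is_ritz_projection ::
  "plane set \<Rightarrow> plane set set \<Rightarrow> pfun set \<Rightarrow> (pfun \<Rightarrow> pfun \<Rightarrow> real) \<Rightarrow> (pfun \<Rightarrow> pfun) \<Rightarrow> pfun \<Rightarrow> pfun \<Rightarrow> bool" where
  "is_ritz_projection \<Omega> \<T> V ah J w r \<longleftrightarrow>
     r \<in> V \<and> (\<forall>v\<in>V. ah r v = hess_form \<Omega> w (smoother \<Omega> \<T> J v))"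

subsection \<open>Time discretization\<close>

definition half_avg :: "(nat \<Rightarrow> pfun) \<Rightarrow> nat \<Rightarrow> pfun" where
  "half_avg \<phi> n = (\<lambda>x. (\<phi> (n + 1) x + \<phi> n x) / 2)"

definition quarter_avg :: "(nat \<Rightarrow> pfun) \<Rightarrow> nat \<Rightarrow> pfun" where
  "quarter_avg \<phi> n = (\<lambda>x. (\<phi> (n + 1) x + 2 * \<phi> n x + \<phi> (n - 1) x) / 4)"

definition dt_half :: "real \<Rightarrow> (nat \<Rightarrow> pfun) \<Rightarrow> nat \<Rightarrow> pfun" where
  "dt_half k \<phi> n = (\<lambda>x. (\<phi> (n + 1) x - \<phi> n x) / k)"

definition dt2 :: "real \<Rightarrow> (nat \<Rightarrow> pfun) \<Rightarrow> nat \<Rightarrow> pfun" where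
  "dt2 k \<phi> n = (\<lambda>x. (\<phi> (n + 1) x - 2 * \<phi> n x + \<phi> (n - 1) x) / k\<^sup>2)"

definition at_grid :: "real \<Rightarrow> (real \<Rightarrow> pfun) \<Rightarrow> nat \<Rightarrow> pfun" where
  "at_grid k f n = f (real n * k)"

definition continuous_L2 :: "real \<Rightarrow> plane set \<Rightarrow> (real \<Rightarrow> pfun) \<Rightarrow> bool" where
  "continuous_L2 T \<Omega> f \<longleftrightarrow> (\<forall>t\<in>{0..T}. f t \<in> L2 \<Omega> \<and>
     ((\<lambda>s. l2_norm \<Omega> (\<lambda>x. f s x - f t x)) \<longlongrightarrow> 0) (at t within {0..T}))"

definition Linf_L2_norm :: "real \<Rightarrow> plane set \<Rightarrow> (real \<Rightarrow> pfun) \<Rightarrow> real" where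
  "Linf_L2_norm T \<Omega> f =
     real_of_ereal (esssup (lebesgue_on {0<..<T}) (\<lambda>t. ereal (l2_norm \<Omega> (f t))))"

definition implicit_scheme ::
  "plane set \<Rightarrow> plane set set \<Rightarrow> pfun set \<Rightarrow> (pfun \<Rightarrow> pfun \<Rightarrow> real) \<Rightarrow> (pfun \<Rightarrow> pfun) \<Rightarrow>
   real \<Rightarrow> nat \<Rightarrow> pfun \<Rightarrow> pfun \<Rightarrow> (real \<Rightarrow> pfun) \<Rightarrow> (nat \<Rightarrow> pfun) \<Rightarrow> bool" where
  "implicit_scheme \<Omega> \<T> V ah J k N u0 v0 f U \<longleftrightarrow>
     (\<forall>n\<le>N. U n \<in> V) \<and>
     is_ritz_projection \<Omega> \<T> V ah J u0 (U 0) \<and>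
     (\<forall>v\<in>V. 2 / k * l2_inner \<Omega> (dt_half k U 0) v + ah (half_avg U 0) v =
        l2_inner \<Omega> (\<lambda>x. half_avg (at_grid k f) 0 x + 2 / k * v0 x) v) \<and>
     (\<forall>n\<in>{1..N - 1}. \<forall>v\<in>V. l2_inner \<Omega> (dt2 k U n) v + ah (quarter_avg U n) v =
        l2_inner \<Omega> (quarter_avg (at_grid k f) n) v)"

end

theory Submission
  imports Defs
begin

text \<open>
  Testing the scheme at step \<open>n\<close> with \<open>D\<^sup>n + D\<^sup>n\<^sup>-\<^sup>1 = 2 (A\<^sup>n - A\<^sup>n\<^sup>-\<^sup>1) / k\<close>, where \<open>D\<^sup>n\<close> is the
  difference quotient and \<open>A\<^sup>n\<close> the average of \<open>U\<close> on the \<open>n\<close>-th time interval, makes the energy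
  \<open>E\<^sup>n = \<parallel>D\<^sup>n\<parallel>\<^sup>2 + a\<^sub>h(A\<^sup>n, A\<^sup>n)\<close> telescope:
  \<open>E\<^sup>n - E\<^sup>n\<^sup>-\<^sup>1 \<le> k F (\<surd>E\<^sup>n + \<surd>E\<^sup>n\<^sup>-\<^sup>1)\<close> with \<open>F\<close> the norm of \<open>f\<close>. Hence \<open>\<surd>E\<close> grows by at most \<open>k F\<close>
  per step, and coercivity and boundedness of \<open>a\<^sub>h\<close> compare \<open>E\<close> with the norms of the claim. The
  values of \<open>f\<close> at the grid points are controlled by the essential supremum because \<open>f\<close> is
  continuous in time.
\<close>

section \<open>The space \<open>L\<^sup>2\<close>\<close>

lemma L2_add: "v \<in> L2 U \<Longrightarrow> w \<in> L2 U \<Longrightarrow> (\<lambda>x. v x + w x) \<in> L2 U"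
proof -
  assume v: "v \<in> L2 U" and w: "w \<in> L2 U"
  have [measurable]: "v \<in> borel_measurable (lebesgue_on U)" "w \<in> borel_measurable (lebesgue_on U)"
    using v w by (auto simp: L2_def)
  have "integrable (lebesgue_on U) (\<lambda>x. (v x + w x)\<^sup>2)"
  proof (rule Bochner_Integration.integrable_bound)
    show "integrable (lebesgue_on U) (\<lambda>x. 2 * (v x)\<^sup>2 + 2 * (w x)\<^sup>2)"
      using v w by (auto simp: L2_def)
    have "(v x + w x)\<^sup>2 \<le> 2 * (v x)\<^sup>2 + 2 * (w x)\<^sup>2" for x
      using sum_squares_bound[of "v x" "w x"] by (simp add: power2_sum)
    then show "AE x in lebesgue_on U. norm ((v x + w x)\<^sup>2) \<le> norm (2 * (v x)\<^sup>2 + 2 * (w x)\<^sup>2)"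
      by simp
  qed measurable
  then show ?thesis by (simp add: L2_def)
qed

lemma L2_cmult: "v \<in> L2 U \<Longrightarrow> (\<lambda>x. c * v x) \<in> L2 U"
  by (auto simp: L2_def power_mult_distrib)

lemma integrable_L2_mult:
  assumes v: "v \<in> L2 U" and w: "w \<in> L2 U"
  shows "integrable (lebesgue_on U) (\<lambda>x. v x * w x)"
proof (rule Bochner_Integration.integrable_bound)
  have [measurable]: "v \<in> borel_measurable (lebesgue_on U)" "w \<in> borel_measurable (lebesgue_on U)"
    using v w by (auto simp: L2_def)
  show "(\<lambda>x. v x * w x) \<in> borel_measurable (lebesgue_on U)" by measurable
  show "integrable (lebesgue_on U) (\<lambda>x. (v x)\<^sup>2 + (w x)\<^sup>2)"
    using v w by (auto simp: L2_def)
  have "\<bar>v x * w x\<bar> \<le> (v x)\<^sup>2 + (w x)\<^sup>2" for x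
  proof -
    have "2 * \<bar>v x\<bar> * \<bar>w x\<bar> \<le> \<bar>v x\<bar>\<^sup>2 + \<bar>w x\<bar>\<^sup>2" by (rule sum_squares_bound)
    moreover have "0 \<le> \<bar>v x\<bar> * \<bar>w x\<bar>" by simp
    ultimately show ?thesis by (simp only: abs_mult power2_abs mult.assoc)
  qed
  then show "AE x in lebesgue_on U. norm (v x * w x) \<le> norm ((v x)\<^sup>2 + (w x)\<^sup>2)"
    by simp
qed

lemma l2_inner_commute: "l2_inner U v w = l2_inner U w v"
  by (simp add: l2_inner_def mult.commute)

lemma l2_inner_add_left:
  "u \<in> L2 U \<Longrightarrow> v \<in> L2 U \<Longrightarrow> w \<in> L2 U \<Longrightarrow>
    l2_inner U (\<lambda>x. u x + v x) w = l2_inner U u w + l2_inner U v w"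
  by (simp add: l2_inner_def distrib_right integrable_L2_mult)

lemma l2_inner_cmult_left: "l2_inner U (\<lambda>x. c * v x) w = c * l2_inner U v w"
  by (simp add: l2_inner_def mult.assoc)

lemma l2_inner_add_right:
  "u \<in> L2 U \<Longrightarrow> v \<in> L2 U \<Longrightarrow> w \<in> L2 U \<Longrightarrow>
    l2_inner U w (\<lambda>x. u x + v x) = l2_inner U w u + l2_inner U w v"
  by (simp add: l2_inner_commute[of U w] l2_inner_add_left)

lemma l2_inner_cmult_right: "l2_inner U w (\<lambda>x. c * v x) = c * l2_inner U w v"
  by (simp add: l2_inner_commute[of U w] l2_inner_cmult_left)

lemma l2_inner_self_nonneg: "0 \<le> l2_inner U v v"
  by (simp add: l2_inner_def)

lemma l2_norm_nonneg: "0 \<le> l2_norm U v"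
  by (simp add: l2_norm_def l2_inner_self_nonneg)

lemma l2_norm_square: "(l2_norm U v)\<^sup>2 = l2_inner U v v"
  by (simp add: l2_norm_def l2_inner_self_nonneg)

text \<open>The quadratic form (s, t) -> ||s v + t w||^2 is nonnegative, so its discriminant cannot
  be positive. Functions that vanish only almost everywhere also have norm zero, hence the separate
  case \<open>q = 0\<close>.\<close>

lemma l2_Cauchy_Schwarz:
  assumes v: "v \<in> L2 U" and w: "w \<in> L2 U"
  shows "l2_inner U v w \<le> l2_norm U v * l2_norm U w"
proof -
  have quad: "0 \<le> s\<^sup>2 * l2_inner U v v + 2 * s * t * l2_inner U v w + t\<^sup>2 * l2_inner U w w"
    for s t
  proof -
    have "0 \<le> l2_inner U (\<lambda>x. s * v x + t * w x) (\<lambda>x. s * v x + t * w x)"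
      by (rule l2_inner_self_nonneg)
    also have "\<dots> = s\<^sup>2 * l2_inner U v v + 2 * s * t * l2_inner U v w + t\<^sup>2 * l2_inner U w w"
      using v w
      by (simp add: l2_inner_add_left l2_inner_add_right L2_add L2_cmult l2_inner_cmult_left
          l2_inner_cmult_right l2_inner_commute[of U w v] power2_eq_square algebra_simps)
    finally show ?thesis .
  qed
  define p q r where "p = l2_inner U v v" and "q = l2_inner U w w" and "r = l2_inner U v w"
  have pq: "0 \<le> p" "0 \<le> q" by (simp_all add: p_def q_def l2_inner_self_nonneg)
  have "r\<^sup>2 \<le> p * q"
  proof (cases "q = 0")
    case True
    have "0 \<le> p + 2 * t * r" for t
      using quad[of 1 t] True by (simp add: p_def q_def r_def)
    \<comment> \<open>If \<open>r\<close> were nonzero, this value of \<open>t\<close> would turn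
      \<open>p + 2 * t * r\<close> into -1.\<close>
    from this[of "- (p + 1) / (2 * r)"] have "r = 0"
      by (cases "r = 0") (auto simp: field_simps)
    then show ?thesis using True by simp
  next
    case False
    \<comment> \<open>The vector q v - r w is q times the part of v orthogonal to w; its squared
      norm is the right-hand side.\<close>
    have "0 \<le> q * (p * q - r\<^sup>2)"
      using quad[of q "- r"] by (simp add: p_def q_def r_def power2_eq_square algebra_simps)
    then show ?thesis using False pq by (simp add: zero_le_mult_iff)
  qed
  then have "\<bar>r\<bar> \<le> sqrt (p * q)"
    by (metis real_sqrt_abs real_sqrt_le_mono)
  then show ?thesis by (simp add: p_def q_def r_def l2_norm_def real_sqrt_mult)
qed

lemma l2_norm_triangle:
  assumes v: "v \<in> L2 U" and w: "w \<in> L2 U"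
  shows "l2_norm U (\<lambda>x. v x + w x) \<le> l2_norm U v + l2_norm U w"
proof (rule power2_le_imp_le)
  have "(l2_norm U (\<lambda>x. v x + w x))\<^sup>2 = (l2_norm U v)\<^sup>2 + 2 * l2_inner U v w + (l2_norm U w)\<^sup>2"
    using v w by (simp add: l2_norm_square l2_inner_add_left l2_inner_add_right L2_add
        l2_inner_commute[of U w v])
  then show "(l2_norm U (\<lambda>x. v x + w x))\<^sup>2 \<le> (l2_norm U v + l2_norm U w)\<^sup>2"
    using l2_Cauchy_Schwarz[OF v w] by (simp add: power2_sum)
qed (simp add: l2_norm_nonneg)

lemma l2_norm_diff_bound:
  assumes v: "v \<in> L2 U" and w: "w \<in> L2 U"
  shows "\<bar>l2_norm U v - l2_norm U w\<bar> \<le> l2_norm U (\<lambda>x. v x - w x)"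
proof -
  have d: "(\<lambda>x. v x - w x) \<in> L2 U"
    using L2_add[OF v L2_cmult[OF w, of "-1"]] by simp
  have n: "l2_norm U (\<lambda>x. w x - v x) = l2_norm U (\<lambda>x. v x - w x)"
    by (simp add: l2_norm_def l2_inner_def algebra_simps)
  have d': "(\<lambda>x. w x - v x) \<in> L2 U"
    using L2_add[OF w L2_cmult[OF v, of "-1"]] by simp
  show ?thesis
    using l2_norm_triangle[OF d w] l2_norm_triangle[OF d' v] n by simp
qed

section \<open>Bounding point values by the essential supremum\<close>

text \<open>The reverse triangle inequality carries continuity of the L^2-valued map over to its
  scalar norm.\<close>

lemma continuous_on_l2_norm:
  assumes "continuous_L2 T \<Omega> f"
  shows "continuous_on {0..T} (\<lambda>t. l2_norm \<Omega> (f t))"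
  unfolding continuous_on_def
proof
  fix t assume t: "t \<in> {0..T}"
  have lim: "((\<lambda>s. l2_norm \<Omega> (\<lambda>x. f s x - f t x)) \<longlongrightarrow> 0) (at t within {0..T})"
    using assms t by (auto simp: continuous_L2_def)
  have "((\<lambda>s. l2_norm \<Omega> (f s) - l2_norm \<Omega> (f t)) \<longlongrightarrow> 0) (at t within {0..T})"
  proof (rule Lim_null_comparison[OF _ lim])
    show "\<forall>\<^sub>F s in at t within {0..T}.
      norm (l2_norm \<Omega> (f s) - l2_norm \<Omega> (f t)) \<le> l2_norm \<Omega> (\<lambda>x. f s x - f t x)"
      unfolding eventually_at_filter real_norm_def
      using assms t by (intro always_eventually) (auto simp: continuous_L2_def intro!: l2_norm_diff_bound)
  qed
  then show "((\<lambda>t. l2_norm \<Omega> (f t)) \<longlongrightarrow> l2_norm \<Omega> (f t)) (at t within {0..T})"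
    by (rule LIM_zero_cancel)
qed

text \<open>The times at which the norm stays below the essential supremum form a closed set that
  has full measure in (0,T). Such a set contains the whole open interval, and then its
  closure.\<close>

lemma l2_norm_le_Linf_L2_norm:
  assumes T: "T > 0" and f: "continuous_L2 T \<Omega> f" and t: "t \<in> {0..T}"
  shows "l2_norm \<Omega> (f t) \<le> Linf_L2_norm T \<Omega> f"
proof -
  let ?g = "\<lambda>t. l2_norm \<Omega> (f t)"
  let ?M = "lebesgue_on {0<..<T}"
  let ?S = "esssup ?M (\<lambda>t. ereal (?g t))"
  have cont: "continuous_on {0..T} ?g" by (rule continuous_on_l2_norm[OF f])
  have "continuous_on {0<..<T} ?g"
    by (rule continuous_on_subset[OF cont]) auto
  then have "?g \<in> borel_measurable ?M"
    by (rule continuous_imp_measurable_on_sets_lebesgue) auto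
  then have meas: "(\<lambda>t. ereal (?g t)) \<in> borel_measurable ?M" by measurable
  \<comment> \<open>\<open>real_of_ereal\<close> sends both infinities to 0, so the essential
    supremum must first be shown finite. Compactness gives the upper bound.\<close>
  have "bounded (?g ` {0..T})"
    by (intro compact_imp_bounded compact_continuous_image[OF cont]) auto
  then obtain B where B: "\<And>s. s \<in> {0..T} \<Longrightarrow> ?g s \<le> B"
    unfolding bounded_iff by (metis abs_le_D1 imageI real_norm_def)
  have "?S \<le> ereal B"
    by (rule esssup_I[OF meas]) (auto intro!: AE_I2 B)
  moreover have "ereal 0 \<le> ?S"
  proof -
    \<comment> \<open>\<open>T > 0\<close> gives the interval positive measure, which makes the
      essential supremum of a constant equal to that constant.\<close>
    have "ereal 0 = esssup ?M (\<lambda>t. ereal 0)"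
      using T by (intro esssup_const[symmetric]) (simp add: emeasure_restrict_space)
    also have "\<dots> \<le> ?S" by (intro esssup_mono) (auto simp: l2_norm_nonneg)
    finally show ?thesis .
  qed
  ultimately have S: "?S = ereal (Linf_L2_norm T \<Omega> f)"
    unfolding Linf_L2_norm_def by (intro ereal_real'[symmetric]) auto
  define C where "C = {s \<in> {0..T}. ?g s \<le> Linf_L2_norm T \<Omega> f}"
  have C: "closed C"
    using continuous_closed_preimage[OF cont, of "{..Linf_L2_norm T \<Omega> f}"]
    by (simp add: C_def vimage_def Int_def)
  have "AE s in ?M. ereal (?g s) \<le> ?S" by (rule esssup_AE)
  then have "AE s \<in> {0<..<T} in lebesgue. s \<in> C"
    unfolding S by (auto simp: AE_restrict_space_iff C_def elim!: eventually_mono)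
  then have "{0<..<T} \<subseteq> C"
    using mem_closed_if_AE_lebesgue_open[OF open_greaterThanLessThan C] by blast
  \<comment> \<open>The closure adds the endpoints 0 and T, which are grid points of the
    scheme.\<close>
  then have "closure {0<..<T} \<subseteq> C"
    using C by (rule closure_minimal)
  then show ?thesis using t T by (auto simp: C_def)
qed

section \<open>Triangulations\<close>

lemma interior_2_simplex_nonempty:
  fixes K :: "plane set"
  assumes "2 simplex K"
  shows "interior K \<noteq> {}"
proof -
  have "aff_dim K = int DIM(plane)" using aff_dim_simplex[OF assms] by simp
  then have "rel_interior K = interior K" by (rule interior_rel_interior)
  moreover have "K \<noteq> {}" using assms by auto
  ultimately show ?thesis
    using convex_simplex[OF assms] rel_interior_eq_empty by blast
qed

text \<open>Lets identities on the open triangle pass by continuity to its vertices and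
  edges.\<close>

lemma closure_interior_2_simplex:
  fixes K :: "plane set"
  assumes "2 simplex K"
  shows "closure (interior K) = K"
  using convex_closure_interior[OF convex_simplex[OF assms] interior_2_simplex_nonempty[OF assms]]
    closed_simplex[OF assms] by simp

text \<open>Completeness of Lebesgue measure: every subset of a null set is measurable. It settles
  the mesh skeleton, where nothing is known about a piecewise function.\<close>

lemma borel_measurable_lebesgue_on_negligible:
  assumes "negligible S"
  shows "f \<in> borel_measurable (lebesgue_on S)"
proof (rule measurableI)
  fix A assume "A \<in> sets (borel :: 'b measure)"
  have "S \<in> sets lebesgue" using assms by (simp add: negligible_iff_null_sets null_sets_def)
  moreover have "f -` A \<inter> S \<in> sets lebesgue"
    using negligible_subset[OF assms, of "f -` A \<inter> S"] by (auto simp: negligible_iff_null_sets null_sets_def)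
  ultimately show "f -` A \<inter> space (lebesgue_on S) \<in> sets (lebesgue_on S)"
    by (simp add: sets_restrict_space_iff)
qed simp

text \<open>Makes the \<open>L2 \<Omega>\<close> calculus available on \<open>V\<close>. Up to the
  null set \<open>Z\<close>, contained in the boundaries of finitely many convex triangles,
  \<open>\<Omega>\<close> is covered by open triangles, on each of which the function is square
  integrable.\<close>

lemma H2_pw_subset_L2:
  assumes \<Omega>: "open \<Omega>" and tri: "triangulation_of \<Omega> \<T>"
  shows "H2_pw \<T> \<subseteq> L2 \<Omega>"
proof
  fix v assume "v \<in> H2_pw \<T>"
  then have v: "v \<in> L2 (interior K)" if "K \<in> \<T>" for K
    using that by (auto simp: H2_pw_def H2_def H1_def)
  have simp2: "2 simplex K" if "K \<in> \<T>" for K using tri that by (auto simp: triangulation_of_def)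
  have fin: "finite \<T>" using tri by (auto simp: triangulation_of_def triangulation_def)
  have cover: "\<Omega> \<subseteq> \<Union>\<T>" using tri closure_subset by (auto simp: triangulation_of_def)
  define Z where "Z = \<Omega> - (\<Union>K\<in>\<T>. interior K)"
  have "Z \<subseteq> (\<Union>K\<in>\<T>. frontier K)"
  proof
    fix x assume x: "x \<in> Z"
    then obtain K where "K \<in> \<T>" "x \<in> K" using cover by (auto simp: Z_def)
    then show "x \<in> (\<Union>K\<in>\<T>. frontier K)"
      using x closure_subset[of K] by (auto simp: Z_def frontier_def)
  qed
  moreover have "negligible (\<Union>K\<in>\<T>. frontier K)"
    using fin simp2 by (auto intro!: negligible_Union negligible_convex_frontier convex_simplex)
  ultimately have Z: "negligible Z" by (rule negligible_subset[rotated])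
  have meas: "v \<in> borel_measurable (lebesgue_on \<Omega>)"
  proof (rule measurable_piecewise_restrict)
    let ?C = "insert Z ((\<lambda>K. interior K) ` \<T>)"
    show "countable ?C" using fin by (simp add: countable_finite)
    show "A \<inter> space (lebesgue_on \<Omega>) \<in> sets (lebesgue_on \<Omega>)" if "A \<in> ?C" for A
      using that \<Omega> Z by (auto simp: sets_restrict_space_iff negligible_iff_null_sets null_sets_def)
    show "space (lebesgue_on \<Omega>) \<subseteq> \<Union>?C" by (auto simp: Z_def)
    show "v \<in> borel_measurable (restrict_space (lebesgue_on \<Omega>) A)" if A: "A \<in> ?C" for A
    proof (cases "A = Z")
      case True
      then have "negligible (\<Omega> \<inter> A)" using Z negligible_subset by blast
      moreover have "restrict_space (lebesgue_on \<Omega>) A = lebesgue_on (\<Omega> \<inter> A)"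
        using \<Omega> Z True
        by (intro restrict_restrict_space) (auto simp: negligible_iff_null_sets null_sets_def)
      ultimately show ?thesis by (simp add: borel_measurable_lebesgue_on_negligible)
    next
      case False
      then obtain K where K: "K \<in> \<T>" "A = interior K" using A by blast
      \<comment> \<open>Restricting either space to the other set yields the same Lebesgue space on
        the intersection, so measurability moves from the triangle to
        \<open>\<Omega>\<close>.\<close>
      have "v \<in> borel_measurable (restrict_space (lebesgue_on (interior K)) \<Omega>)"
        using v[OF K(1)] by (auto simp: L2_def intro: measurable_restrict_space1)
      moreover have "restrict_space (lebesgue_on (interior K)) \<Omega> = lebesgue_on (interior K \<inter> \<Omega>)"
        using \<Omega> by (intro restrict_restrict_space) auto
      moreover have "restrict_space (lebesgue_on \<Omega>) A = lebesgue_on (\<Omega> \<inter> A)"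
        using \<Omega> K by (intro restrict_restrict_space) auto
      ultimately show ?thesis by (metis Int_commute K(2))
    qed
  qed
  have "integrable (lebesgue_on \<Omega>) (\<lambda>x. (v x)\<^sup>2)"
  proof -
    \<comment> \<open>Off \<open>Z\<close> every point of \<open>\<Omega>\<close> lies in some open
      triangle, so the sum over all triangles dominates.\<close>
    have "integrable lebesgue (\<lambda>x. indicator \<Omega> x *\<^sub>R (v x)\<^sup>2)"
    proof (rule Bochner_Integration.integrable_bound)
      show "integrable lebesgue (\<lambda>x. \<Sum>K\<in>\<T>. indicator (interior K) x *\<^sub>R (v x)\<^sup>2)"
      proof (rule Bochner_Integration.integrable_sum)
        fix K assume "K \<in> \<T>"
        from v[OF this] have "integrable (lebesgue_on (interior K)) (\<lambda>x. (v x)\<^sup>2)"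
          by (simp add: L2_def)
        then show "integrable lebesgue (\<lambda>x. indicator (interior K) x *\<^sub>R (v x)\<^sup>2)"
          by (subst (asm) integrable_restrict_space) auto
      qed
      show "(\<lambda>x. indicator \<Omega> x *\<^sub>R (v x)\<^sup>2) \<in> borel_measurable lebesgue"
        using borel_measurable_power[OF meas, of 2] \<Omega>
        by (subst (asm) borel_measurable_restrict_space_iff) auto
      have "AE x in lebesgue. x \<notin> Z"
        using Z by (simp add: negligible_iff_null_sets AE_not_in)
      then show "AE x in lebesgue. norm (indicator \<Omega> x *\<^sub>R (v x)\<^sup>2)
          \<le> norm (\<Sum>K\<in>\<T>. indicator (interior K) x *\<^sub>R (v x)\<^sup>2)"
      proof eventually_elim
        fix x assume x: "x \<notin> Z"
        have nn: "0 \<le> (\<Sum>K\<in>\<T>. indicator (interior K) x *\<^sub>R (v x)\<^sup>2)"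
          by (intro sum_nonneg) (simp add: indicator_def)
        show "norm (indicator \<Omega> x *\<^sub>R (v x)\<^sup>2)
          \<le> norm (\<Sum>K\<in>\<T>. indicator (interior K) x *\<^sub>R (v x)\<^sup>2)"
        proof (cases "x \<in> \<Omega>")
          case True
          with x obtain K where K: "K \<in> \<T>" "x \<in> interior K" by (auto simp: Z_def)
          have "indicator (interior K) x *\<^sub>R (v x)\<^sup>2
              \<le> (\<Sum>K\<in>\<T>. indicator (interior K) x *\<^sub>R (v x)\<^sup>2)"
            by (rule member_le_sum[OF K(1) _ fin]) (simp add: indicator_def)
          then show ?thesis using True K nn by simp
        qed simp
      qed
    qed
    then show ?thesis using \<Omega> by (subst integrable_restrict_space) auto
  qed
  with meas show "v \<in> L2 \<Omega>" by (simp add: L2_def)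
qed

section \<open>The zero function belongs to the Morley space\<close>

lemma val_zero:
  assumes K: "2 simplex K" and z: "z \<in> K"
  shows "val K (\<lambda>x. 0) z = 0"
proof -
  \<comment> \<open>\<open>val\<close> is an arbitrary choice, so only its defining property is
    usable: a continuous function vanishing almost everywhere has a closed zero set of full measure,
    hence vanishes on the open triangle and on its closure.\<close>
  have "continuous_on K (val K (\<lambda>x. 0)) \<and> (AE x in lebesgue_on K. val K (\<lambda>x. 0) x = 0)"
    unfolding val_def by (rule someI[of _ "\<lambda>x. 0"]) simp
  then have c: "continuous_on K (val K (\<lambda>x. 0))" and ae: "AE x in lebesgue_on K. val K (\<lambda>x. 0) x = 0"
    by auto
  define C where "C = {x \<in> K. val K (\<lambda>x. 0) x = 0}"
  have C: "closed C"
    unfolding C_def using continuous_closed_preimage_constant[OF c closed_simplex[OF K]] .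
  have "K \<in> sets lebesgue" using closed_simplex[OF K] by auto
  with ae have "AE x \<in> interior K in lebesgue. x \<in> C"
    using interior_subset by (auto simp: AE_restrict_space_iff C_def elim!: eventually_mono)
  then have "interior K \<subseteq> C"
    using mem_closed_if_AE_lebesgue_open[OF open_interior C] by blast
  then have "closure (interior K) \<subseteq> C"
    using C by (rule closure_minimal)
  then show ?thesis using z closure_interior_2_simplex[OF K] by (auto simp: C_def)
qed

text \<open>Uniqueness of the derivative determines the chosen gradient on the open triangle, and
  continuity determines it up to the boundary.\<close>

lemma grad_val_zero:
  assumes K: "2 simplex K" and z: "z \<in> K"
  shows "grad_val K (\<lambda>x. 0) z = 0"
proof -
  have der0: "(val K (\<lambda>x. 0) has_derivative (\<lambda>y. 0)) (at x)" if x: "x \<in> interior K" for x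
    by (rule has_derivative_transform_within_open[of "\<lambda>x. 0" _ _ _ "interior K"])
      (use x interior_subset[of K] in \<open>auto simp: val_zero[OF K] subset_iff\<close>)
  let ?G = "grad_val K (\<lambda>x. 0)"
  have "continuous_on K ?G \<and> (\<forall>x\<in>interior K. (val K (\<lambda>x. 0) has_derivative (\<lambda>y. ?G x \<bullet> y)) (at x))"
    unfolding grad_val_def by (rule someI[of _ "\<lambda>x. 0"]) (simp add: der0)
  then have c: "continuous_on K ?G"
    and d: "\<And>x. x \<in> interior K \<Longrightarrow> (val K (\<lambda>x. 0) has_derivative (\<lambda>y. ?G x \<bullet> y)) (at x)"
    by auto
  have "?G x = 0" if x: "x \<in> interior K" for x
    using has_derivative_unique[OF d[OF x] der0[OF x]] by (metis inner_eq_zero_iff)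
  then show ?thesis
    using continuous_constant_on_closure[of "interior K" ?G 0 z] c z closure_interior_2_simplex[OF K]
    by simp
qed

text \<open>The choice in \<open>edge_ends\<close> is meaningful only once an edge is known to be a
  segment: a one-dimensional face of a polytope is a 1-simplex, the hull of two points.\<close>

lemma edge_mid_in_simplex:
  assumes K: "n simplex K" and e: "e edge_of K"
  shows "edge_mid e \<in> K"
proof -
  have f: "e face_of K" and d: "aff_dim e = 1" using e by (auto simp: edge_of_def)
  have "polytope e" using face_of_polytope_polytope[OF simplex_imp_polytope[OF K] f] .
  then obtain m where "m simplex e" using polytope_lowdim_imp_simplex d by (metis order_refl)
  with d have "1 simplex e" by (metis aff_dim_simplex)
  then obtain C where C: "int (card C) = 2" "e = convex hull C" by (auto simp: simplex_def)
  then obtain a b where "C = {a, b}" by (metis card_2_iff of_nat_eq_iff of_nat_numeral)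
  then have "\<exists>p. case p of (a, b) \<Rightarrow> e = closed_segment a b"
    using C by (auto simp: segment_convex_hull)
  then have "case edge_ends e of (a, b) \<Rightarrow> e = closed_segment a b"
    unfolding edge_ends_def by (rule someI_ex)
  then have "edge_mid e \<in> e"
    by (auto simp: edge_mid_def split: prod.splits)
  then show ?thesis using face_of_imp_subset[OF f] by auto
qed

text \<open>Embeds \<open>V\<close> in the sum of \<open>V\<close> and the Morley space, on which
  bilinearity of the discrete form is assumed.\<close>

lemma zero_in_Morley:
  assumes "triangulation_of \<Omega> \<T>"
  shows "(\<lambda>x. 0) \<in> Morley \<Omega> \<T>"
proof -
  have simp2: "2 simplex K" if "K \<in> \<T>" for K using assms that by (auto simp: triangulation_of_def)
  have "(\<lambda>x. 0) \<in> polynomial_le 2"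
    unfolding polynomial_le_def by (auto intro!: exI[of _ "\<lambda>i j. 0"])
  then have "(\<lambda>x. 0) \<in> P_pw 2 \<T>"
    unfolding P_pw_def by (auto intro!: bexI[of _ "\<lambda>x. 0"])
  then show ?thesis
    unfolding Morley_def using simp2
    by (auto simp: val_zero grad_val_zero[OF simp2 edge_mid_in_simplex[OF simp2]])
qed

lemma subset_fun_set_plus_left: "(\<lambda>x. 0) \<in> W \<Longrightarrow> V \<subseteq> fun_set_plus V W"
  by (force simp: fun_set_plus_def)

section \<open>The energy estimate\<close>

lemma symmetric_bilinear_on_subset:
  "symmetric_bilinear_on \<Omega> W b \<Longrightarrow> V \<subseteq> W \<Longrightarrow> symmetric_bilinear_on \<Omega> V b"
  unfolding symmetric_bilinear_on_def by (meson subsetD)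

lemma fin_dim_subspace_add:
  "fin_dim_subspace \<Omega> V \<Longrightarrow> v \<in> V \<Longrightarrow> w \<in> V \<Longrightarrow> (\<lambda>x. v x + w x) \<in> V"
  by (simp add: fin_dim_subspace_def)

lemma fin_dim_subspace_cmult:
  "fin_dim_subspace \<Omega> V \<Longrightarrow> v \<in> V \<Longrightarrow> (\<lambda>x. c * v x) \<in> V"
  by (simp add: fin_dim_subspace_def)

text \<open>By symmetry the cross terms of (A + B)(A - B) cancel. Differences are written with the
  factor \<open>-1\<close> so that closure of \<open>V\<close> under sums and multiples applies
  directly.\<close>

lemma bilinear_sum_difference:
  assumes V: "fin_dim_subspace \<Omega> V" and b: "symmetric_bilinear_on \<Omega> V b"
    and A: "A \<in> V" and B: "B \<in> V"
  shows "b (\<lambda>x. s * (A x + B x)) (\<lambda>x. t * (A x + (-1) * B x)) = s * t * (b A A - b B B)"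
proof -
  have "\<forall>v\<in>V. \<forall>w\<in>V. b v w = b w v"
    using b unfolding symmetric_bilinear_on_def by (elim conjE)
  note sym = this[rule_format]
  have "\<forall>u\<in>V. \<forall>v\<in>V. \<forall>w\<in>V. b (\<lambda>x. u x + v x) w = b u w + b v w"
    using b unfolding symmetric_bilinear_on_def by (elim conjE)
  note add = this[rule_format]
  have "\<forall>c. \<forall>v\<in>V. \<forall>w\<in>V. b (\<lambda>x. c * v x) w = c * b v w"
    using b unfolding symmetric_bilinear_on_def by (elim conjE)
  note cmult = this[rule_format]
  note Va = fin_dim_subspace_add[OF V] and Vc = fin_dim_subspace_cmult[OF V]
  define P Q where "P = (\<lambda>x. A x + B x)" and "Q = (\<lambda>x. A x + (-1) * B x)"
  have P: "P \<in> V" and Q: "Q \<in> V" unfolding P_def Q_def by (intro Va Vc A B)+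
  \<comment> \<open>\<open>symmetric_bilinear_on\<close> states linearity in the first argument;
    symmetry transfers it to the second.\<close>
  have right: "b w Q = b w A - b w B" if w: "w \<in> V" for w
  proof -
    have "b w Q = b Q w" by (rule sym[OF w Q])
    also have "\<dots> = b A w + (-1) * b B w"
      unfolding Q_def using add[OF A Vc[OF B, of "-1"] w] cmult[OF B w, of "-1"] by simp
    finally show ?thesis by (simp add: sym[OF A w] sym[OF B w])
  qed
  have "b (\<lambda>x. s * P x) (\<lambda>x. t * Q x) = s * b P (\<lambda>x. t * Q x)"
    by (rule cmult[OF P Vc[OF Q]])
  also have "b P (\<lambda>x. t * Q x) = t * b P Q"
    unfolding sym[OF P Vc[OF Q]] sym[OF P Q] by (rule cmult[OF Q P])
  also have "b P Q = b A A - b B B"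
    unfolding P_def add[OF A B Q] right[OF A] right[OF B] sym[OF A B] by simp
  finally show ?thesis by (simp add: P_def Q_def)
qed

section \<open>The discrete energy and its growth over one time step\<close>

definition energy ::
  "plane set \<Rightarrow> (pfun \<Rightarrow> pfun \<Rightarrow> real) \<Rightarrow> real \<Rightarrow> (nat \<Rightarrow> pfun) \<Rightarrow> nat \<Rightarrow> real" where
  "energy \<Omega> b k U n = (l2_norm \<Omega> (dt_half k U n))\<^sup>2 + b (half_avg U n) (half_avg U n)"

lemma dt_half_in_subspace:
  assumes V: "fin_dim_subspace \<Omega> V" and "U n \<in> V" "U (Suc n) \<in> V"
  shows "dt_half k U n \<in> V"
proof -
  have "(\<lambda>x. (1 / k) * (U (Suc n) x + (-1) * U n x)) \<in> V"
    by (intro fin_dim_subspace_add[OF V] fin_dim_subspace_cmult[OF V] assms)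
  then show ?thesis by (simp add: dt_half_def)
qed

lemma half_avg_in_subspace:
  assumes V: "fin_dim_subspace \<Omega> V" and "U n \<in> V" "U (Suc n) \<in> V"
  shows "half_avg U n \<in> V"
proof -
  have "(\<lambda>x. (1 / 2) * (U (Suc n) x + U n x)) \<in> V"
    by (intro fin_dim_subspace_add[OF V] fin_dim_subspace_cmult[OF V] assms)
  then show ?thesis by (simp add: half_avg_def)
qed

text \<open>The load enters only as a functional \<open>g\<close> bounded by \<open>F\<close>. The
  equation is indexed by \<open>Suc n\<close>, so its predecessor is exactly \<open>n\<close> and
  truncated subtraction does no harm.\<close>

lemma energy_step:
  assumes V: "fin_dim_subspace \<Omega> V" and VL: "V \<subseteq> L2 \<Omega>" and b: "symmetric_bilinear_on \<Omega> V b"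
    and pos: "\<And>w. w \<in> V \<Longrightarrow> 0 \<le> b w w" and k: "k > 0" and F: "F \<ge> 0"
    and U: "U n \<in> V" "U (Suc n) \<in> V" "U (Suc (Suc n)) \<in> V"
    and scheme: "\<And>v. v \<in> V \<Longrightarrow>
      l2_inner \<Omega> (dt2 k U (Suc n)) v + b (quarter_avg U (Suc n)) v = l2_inner \<Omega> g v"
    and g: "\<And>v. v \<in> L2 \<Omega> \<Longrightarrow> l2_inner \<Omega> g v \<le> F * l2_norm \<Omega> v"
  shows "sqrt (energy \<Omega> b k U (Suc n)) \<le> sqrt (energy \<Omega> b k U n) + k * F"
proof -
  define D D' A A' where "D = dt_half k U n" and "D' = dt_half k U (Suc n)"
    and "A = half_avg U n" and "A' = half_avg U (Suc n)"
  have DV: "D \<in> V" "D' \<in> V" and AV: "A \<in> V" "A' \<in> V"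
    unfolding D_def D'_def A_def A'_def
    by (intro dt_half_in_subspace[OF V] half_avg_in_subspace[OF V] U)+
  then have DL: "D \<in> L2 \<Omega>" "D' \<in> L2 \<Omega>" using VL by auto
  define v where "v = (\<lambda>x. D' x + D x)"
  have vV: "v \<in> V" unfolding v_def by (intro fin_dim_subspace_add[OF V] DV)
  have vL: "v \<in> L2 \<Omega>" using VL vV by auto
  \<comment> \<open>The test function has two faces: as a sum of difference quotients it meets
    \<open>dt2\<close>, their scaled difference; as a scaled difference of averages it meets
    \<open>quarter_avg\<close>, their mean. Both products become differences of squares.\<close>
  have v_A: "v = (\<lambda>x. (2 / k) * (A' x + (-1) * A x))"
    by (rule ext) (use k in \<open>simp add: v_def D_def D'_def A_def A'_def dt_half_def half_avg_def field_simps\<close>)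
  have q_A: "quarter_avg U (Suc n) = (\<lambda>x. (1 / 2) * (A' x + A x))"
    by (rule ext) (simp add: quarter_avg_def A_def A'_def half_avg_def field_simps)
  have d_D: "dt2 k U (Suc n) = (\<lambda>x. (1 / k) * (D' x + (-1) * D x))"
    by (rule ext) (use k in \<open>simp add: dt2_def D_def D'_def dt_half_def field_simps power2_eq_square\<close>)
  have "b (quarter_avg U (Suc n)) v = (1 / k) * (b A' A' - b A A)"
    unfolding q_A v_A bilinear_sum_difference[OF V b AV(2,1)] by simp
  moreover have "l2_inner \<Omega> (dt2 k U (Suc n)) v = (1 / k) * ((l2_norm \<Omega> D')\<^sup>2 - (l2_norm \<Omega> D)\<^sup>2)"
  proof -
    have "l2_inner \<Omega> (\<lambda>x. D' x + (-1) * D x) v = l2_inner \<Omega> D' v + (-1) * l2_inner \<Omega> D v"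
      by (simp only: l2_inner_add_left[OF DL(2) L2_cmult[OF DL(1)] vL] l2_inner_cmult_left)
    also have "\<dots> = (l2_norm \<Omega> D')\<^sup>2 - (l2_norm \<Omega> D)\<^sup>2"
      using DL by (simp add: v_def l2_inner_add_right l2_norm_square l2_inner_commute[of \<Omega> D D'])
    finally show ?thesis unfolding d_D l2_inner_cmult_left by simp
  qed
  ultimately have "(1 / k) * (energy \<Omega> b k U (Suc n) - energy \<Omega> b k U n) = l2_inner \<Omega> g v"
    using scheme[OF vV]
    by (simp add: energy_def D_def D'_def A_def A'_def add_divide_distrib diff_divide_distrib)
  then have diff: "energy \<Omega> b k U (Suc n) - energy \<Omega> b k U n = k * l2_inner \<Omega> g v"
    using k by (simp add: field_simps)
  define r r' where "r = sqrt (energy \<Omega> b k U n)" and "r' = sqrt (energy \<Omega> b k U (Suc n))"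
  have E0: "0 \<le> energy \<Omega> b k U n" "0 \<le> energy \<Omega> b k U (Suc n)"
    using pos AV by (simp_all add: energy_def A_def A'_def)
  have r0: "0 \<le> r" "0 \<le> r'" using E0 by (simp_all add: r_def r'_def)
  \<comment> \<open>Nonnegativity of \<open>b\<close> on the diagonal lets the square root of the
    energy control its kinetic part.\<close>
  have "l2_norm \<Omega> D \<le> r" "l2_norm \<Omega> D' \<le> r'"
    unfolding r_def r'_def using pos AV
    by (intro real_le_rsqrt; simp add: energy_def D_def D'_def A_def A'_def)+
  then have "l2_norm \<Omega> v \<le> r' + r"
    using l2_norm_triangle[OF DL(2,1)] by (simp add: v_def)
  then have "l2_inner \<Omega> g v \<le> F * (r' + r)"
    using g[OF vL] mult_left_mono[OF _ F] by (meson order_trans)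
  then have "r'\<^sup>2 - r\<^sup>2 \<le> k * (F * (r' + r))"
    using diff k E0 by (simp add: r_def r'_def)
  then have "(r' + r) * (r' - r) \<le> (r' + r) * (k * F)"
    by (simp add: power2_eq_square algebra_simps)
  \<comment> \<open>Cancel the common factor \<open>r' + r\<close>; if it is zero, both roots vanish
    and \<open>k * F\<close> is nonnegative.\<close>
  then have "r' \<le> r + k * F"
  proof (cases "r' + r = 0")
    case True
    moreover have "0 \<le> k * F" using k F by simp
    ultimately show ?thesis using r0 by linarith
  next
    case False
    then have "0 < r' + r" using r0 by linarith
    with \<open>(r' + r) * (r' - r) \<le> (r' + r) * (k * F)\<close> have "r' - r \<le> k * F"
      by (simp only: mult_le_cancel_left_pos)
    then show ?thesis by simp
  qed
  then show ?thesis by (simp add: r_def r'_def)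
qed

text \<open>The weights 1/4, 1/2, 1/4 sum to one, so the average inherits the common bound
  \<open>F\<close>.\<close>

lemma l2_inner_quarter_avg_le:
  assumes f: "\<And>m. m \<in> {n - 1, n, n + 1} \<Longrightarrow> \<phi> m \<in> L2 \<Omega> \<and> l2_norm \<Omega> (\<phi> m) \<le> F"
    and v: "v \<in> L2 \<Omega>"
  shows "l2_inner \<Omega> (quarter_avg \<phi> n) v \<le> F * l2_norm \<Omega> v"
proof -
  have le: "l2_inner \<Omega> (\<phi> m) v \<le> F * l2_norm \<Omega> v" if "m \<in> {n - 1, n, n + 1}" for m
    using l2_Cauchy_Schwarz[of "\<phi> m" \<Omega> v] f[OF that] v
      mult_right_mono[of "l2_norm \<Omega> (\<phi> m)" F "l2_norm \<Omega> v"] l2_norm_nonneg[of \<Omega> v] by linarith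
  have L: "\<phi> (n + 1) \<in> L2 \<Omega>" "\<phi> n \<in> L2 \<Omega>" "\<phi> (n - 1) \<in> L2 \<Omega>" using f by auto
  have "quarter_avg \<phi> n = (\<lambda>x. (1 / 4) * ((\<phi> (n + 1) x + 2 * \<phi> n x) + \<phi> (n - 1) x))"
    by (simp add: quarter_avg_def)
  then have "l2_inner \<Omega> (quarter_avg \<phi> n) v
      = (1 / 4) * ((l2_inner \<Omega> (\<phi> (n + 1)) v + 2 * l2_inner \<Omega> (\<phi> n) v) + l2_inner \<Omega> (\<phi> (n - 1)) v)"
    by (simp only: l2_inner_cmult_left l2_inner_add_left[OF L2_add[OF L(1) L2_cmult[OF L(2)]] L(3) v]
        l2_inner_add_left[OF L(1) L2_cmult[OF L(2)] v])
  then show ?thesis using le[of "n + 1"] le[of n] le[of "n - 1"] by simp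
qed

section \<open>From the energy back to the norms of the stability estimate\<close>

lemma discrete_norm_nonneg: "0 \<le> discrete_norm \<Omega> \<T> v"
  unfolding discrete_norm_def by (simp add: sum_nonneg)

theorem theorem4p2:
  fixes \<alpha> \<beta> T :: real
  assumes "\<alpha> > 0" and "\<beta> > 0" and "T > 0"
  shows "\<exists>C>0. \<forall>\<Omega> \<T> \<sigma> V ah J (N :: nat) k u0 v0 f U.
    polygonal_lipschitz_domain \<Omega> \<longrightarrow>
    triangulation_of \<Omega> \<T> \<longrightarrow> shape_regular \<sigma> \<T> \<longrightarrow>
    V \<subseteq> H2_pw \<T> \<longrightarrow> fin_dim_subspace \<Omega> V \<longrightarrow>
    symmetric_bilinear_on \<Omega> (fun_set_plus V (Morley \<Omega> \<T>)) ah \<longrightarrow>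
    (\<forall>w\<in>V. \<alpha> * (discrete_norm \<Omega> \<T> w)\<^sup>2 \<le> ah w w) \<longrightarrow>
    (\<forall>w\<in>V. \<forall>v\<in>V. ah w v \<le> \<beta> * discrete_norm \<Omega> \<T> w * discrete_norm \<Omega> \<T> v) \<longrightarrow>
    companion_operator \<Omega> \<T> J \<longrightarrow>
    N > 0 \<longrightarrow> k = T / real N \<longrightarrow>
    u0 \<in> H20 \<Omega> \<longrightarrow> v0 \<in> L2 \<Omega> \<longrightarrow> continuous_L2 T \<Omega> f \<longrightarrow>
    implicit_scheme \<Omega> \<T> V ah J k N u0 v0 f U \<longrightarrow>
    (\<forall>m\<in>{1..N - 1}.
       l2_norm \<Omega> (dt_half k U m) + discrete_norm \<Omega> \<T> (half_avg U m)
       \<le> C * (l2_norm \<Omega> (dt_half k U 0) + discrete_norm \<Omega> \<T> (half_avg U 0)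
              + Linf_L2_norm T \<Omega> f))"
proof -
  \<comment> \<open>The second factor bounds the energy root at step m by the data: 1 and
    \<open>sqrt \<beta>\<close> come from the initial energy, \<open>T\<close> from the accumulated
    load. The first factor returns to the norms: 1 for the kinetic part,
    \<open>1 / sqrt \<alpha>\<close> by coercivity. \<open>C\<close> is fixed before mesh and time
    step.\<close>
  define C where "C = (1 + 1 / sqrt \<alpha>) * (1 + sqrt \<beta> + T)"
  have "C > 0" using assms by (simp add: C_def add_pos_pos)
  show ?thesis
  proof (intro exI[of _ C] conjI allI impI ballI, fact)
    fix \<Omega> \<T> \<sigma> V ah J and N :: nat and k u0 v0 f U m
    assume dom: "polygonal_lipschitz_domain \<Omega>" and tri: "triangulation_of \<Omega> \<T>"
      and "V \<subseteq> H2_pw \<T>" and V: "fin_dim_subspace \<Omega> V"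
      and bil: "symmetric_bilinear_on \<Omega> (fun_set_plus V (Morley \<Omega> \<T>)) ah"
      and coer: "\<forall>w\<in>V. \<alpha> * (discrete_norm \<Omega> \<T> w)\<^sup>2 \<le> ah w w"
      and bdd: "\<forall>w\<in>V. \<forall>v\<in>V. ah w v \<le> \<beta> * discrete_norm \<Omega> \<T> w * discrete_norm \<Omega> \<T> v"
      and N: "N > 0" and k: "k = T / real N" and f: "continuous_L2 T \<Omega> f"
      and scheme: "implicit_scheme \<Omega> \<T> V ah J k N u0 v0 f U" and m: "m \<in> {1..N - 1}"
    define F where "F = Linf_L2_norm T \<Omega> f"
    define E where "E = energy \<Omega> ah k U"
    have VL: "V \<subseteq> L2 \<Omega>"
      using \<open>V \<subseteq> H2_pw \<T>\<close> H2_pw_subset_L2[OF _ tri] dom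
      by (auto simp: polygonal_lipschitz_domain_def)
    have ah: "symmetric_bilinear_on \<Omega> V ah"
      by (rule symmetric_bilinear_on_subset[OF bil subset_fun_set_plus_left[OF zero_in_Morley[OF tri]]])
    have pos: "0 \<le> ah w w" if "w \<in> V" for w
      using coer that assms(1) by (meson less_imp_le mult_nonneg_nonneg order_trans zero_le_power2)
    have k0: "k > 0" using k N assms(3) by simp
    have fF: "l2_norm \<Omega> (f t) \<le> F" "f t \<in> L2 \<Omega>" if "t \<in> {0..T}" for t
      using l2_norm_le_Linf_L2_norm[OF assms(3) f that] f that
      by (auto simp: F_def continuous_L2_def)
    have F: "0 \<le> F"
      using fF(1)[of 0] l2_norm_nonneg[of \<Omega> "f 0"] assms(3) by simp
    have UV: "U n \<in> V" if "n \<le> N" for n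
      using scheme that by (auto simp: implicit_scheme_def)
    have grid: "real n * k \<in> {0..T}" if "n \<le> N" for n
      using that N assms(3) by (simp add: k field_simps)
    have growth: "sqrt (E n) \<le> sqrt (E 0) + real n * k * F" if "n \<le> N - 1" for n
      using that
    proof (induction n)
      case (Suc n)
      \<comment> \<open>The energy at \<open>Suc n\<close> involves \<open>U\<close> at
        \<open>n + 2\<close>, so the induction runs only up to \<open>N - 1\<close>.\<close>
      then have n: "Suc (Suc n) \<le> N" by simp
      have "sqrt (E (Suc n)) \<le> sqrt (E n) + k * F"
        unfolding E_def
      proof (rule energy_step[OF V VL ah pos k0 F])
        show "U n \<in> V" "U (Suc n) \<in> V" "U (Suc (Suc n)) \<in> V" using n UV by simp_all
        show "l2_inner \<Omega> (dt2 k U (Suc n)) v + ah (quarter_avg U (Suc n)) v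
            = l2_inner \<Omega> (quarter_avg (at_grid k f) (Suc n)) v" if "v \<in> V" for v
          using scheme that Suc.prems by (auto simp: implicit_scheme_def)
        show "l2_inner \<Omega> (quarter_avg (at_grid k f) (Suc n)) v \<le> F * l2_norm \<Omega> v"
          if "v \<in> L2 \<Omega>" for v
        proof (rule l2_inner_quarter_avg_le[OF _ that])
          fix j assume "j \<in> {Suc n - 1, Suc n, Suc n + 1}"
          then have "j \<le> N" using n by auto
          then show "at_grid k f j \<in> L2 \<Omega> \<and> l2_norm \<Omega> (at_grid k f j) \<le> F"
            using fF[OF grid] by (simp add: at_grid_def)
        qed
      qed
      then show ?case using Suc by (simp add: algebra_simps)
    qed simp
    have HV: "half_avg U n \<in> V" if "n \<le> N - 1" for n
      using that N by (intro half_avg_in_subspace[OF V] UV) auto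
    have mT: "real m * k * F \<le> T * F"
      using grid[of m] m F by (intro mult_right_mono) auto
    let ?d = "l2_norm \<Omega> (dt_half k U 0)" and ?a = "discrete_norm \<Omega> \<T> (half_avg U 0)"
    \<comment> \<open>Boundedness of the form on the diagonal controls the initial potential
      energy.\<close>
    have "E 0 \<le> ?d\<^sup>2 + \<beta> * ?a * ?a"
      using bdd HV[of 0] by (simp add: E_def energy_def)
    also have "\<dots> = ?d\<^sup>2 + (sqrt \<beta> * ?a)\<^sup>2"
      using assms(2) by (simp add: power_mult_distrib power2_eq_square[of ?a])
    finally have "sqrt (E 0) \<le> sqrt (?d\<^sup>2 + (sqrt \<beta> * ?a)\<^sup>2)" by simp
    also have "\<dots> \<le> ?d + sqrt \<beta> * ?a"
      using assms(2) by (intro sqrt_sum_squares_le_sum) (simp_all add: l2_norm_nonneg discrete_norm_nonneg)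
    finally have E0: "sqrt (E 0) \<le> ?d + sqrt \<beta> * ?a" .
    have "sqrt (E m) \<le> ?d + sqrt \<beta> * ?a + T * F"
      using growth[of m] m mT E0 by simp
    also have "\<dots> \<le> (1 + sqrt \<beta> + T) * (?d + ?a + F)"
    proof -
      \<comment> \<open>These are the terms left over when the product on the right is expanded and
        the left side subtracted.\<close>
      have "0 \<le> ?a + F + sqrt \<beta> * (?d + F) + T * (?d + ?a)"
        using assms F by (simp add: l2_norm_nonneg discrete_norm_nonneg)
      then show ?thesis by (simp add: algebra_simps)
    qed
    finally have Em: "sqrt (E m) \<le> (1 + sqrt \<beta> + T) * (?d + ?a + F)" .
    have Hm: "half_avg U m \<in> V" using HV m by simp
    have "l2_norm \<Omega> (dt_half k U m) \<le> sqrt (E m)"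
      using pos[OF Hm] by (intro real_le_rsqrt) (simp add: E_def energy_def)
    moreover have "discrete_norm \<Omega> \<T> (half_avg U m) \<le> 1 / sqrt \<alpha> * sqrt (E m)"
    proof -
      \<comment> \<open>Coercivity bounds the squared left side by the potential part of
        \<open>E m\<close>, and the kinetic part is nonnegative.\<close>
      have "sqrt \<alpha> * discrete_norm \<Omega> \<T> (half_avg U m) \<le> sqrt (E m)"
        using coer Hm assms(1)
        by (intro real_le_rsqrt) (auto simp: power_mult_distrib E_def energy_def intro: add_increasing)
      then show ?thesis using assms(1) by (simp add: field_simps)
    qed
    ultimately have "l2_norm \<Omega> (dt_half k U m) + discrete_norm \<Omega> \<T> (half_avg U m)
        \<le> (1 + 1 / sqrt \<alpha>) * sqrt (E m)"
      by (simp add: algebra_simps)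
    also have "\<dots> \<le> (1 + 1 / sqrt \<alpha>) * ((1 + sqrt \<beta> + T) * (?d + ?a + F))"
      using Em assms(1) by (intro mult_left_mono) auto
    finally show "l2_norm \<Omega> (dt_half k U m) + discrete_norm \<Omega> \<T> (half_avg U m)
        \<le> C * (?d + ?a + Linf_L2_norm T \<Omega> f)"
      by (simp add: C_def F_def mult.assoc)
  qed
qed

end
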